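(* Let $z\in\mathbb C$ such that $|z|<1$, and $\beta,\gamma\in\mathbb C$ such that $\beta+\gamma+\tfrac12\notin-\mathbb N_0$. Then $$C_{2\gamma+1}^\beta(z)=\frac{2^{2\gamma+2}\,\Gamma(\beta+\gamma+\frac12)}{\Gamma(-\gamma-\frac12)\Gamma(2\gamma+2)\Gamma(\beta)(1-z^2)^{\beta+\gamma+\frac12}}\,Q_{-\gamma-1}^{(-\frac12,\beta+2\gamma+1)}\Bigl(\frac{1+z^2}{1-z^2}\Bigr),$$ $$C_{2\gamma}^\beta(z)=\frac{2^{2\gamma+1}\,\Gamma(\beta+\gamma+\frac12)\,z}{\Gamma(-\gamma+\frac12)\Gamma(2\gamma+1)\Gamma(\beta)(1-z^2)^{\beta+\gamma+\frac12}}\,Q_{-\gamma-1}^{(\frac12,\beta+2\gamma)}\Bigl(\frac{1+z^2}{1-z^2}\Bigr).$$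
   Context: $\mathbb N=\{1,2,3,\dots\}$, $\mathbb N_0=\mathbb N\cup\{0\}$; $(a)_n=a(a+1)\cdots(a+n-1)$. ${}_2\mathbf F_1(a,b;c;z)=\sum_{k\ge0}\frac{(a)_k(b)_k}{\Gamma(c+k)}\frac{z^k}{k!}$ ($|z|<1$, and elsewhere by analytic continuation) is the Olver normalized Gauss hypergeometric function. Gegenbauer function of the first kind ($\lambda+2\mu\notin-\mathbb N_0$): $C_\lambda^\mu(z)=\frac{\sqrt\pi\,\Gamma(\lambda+2\mu)}{2^{2\mu-1}\Gamma(\mu)\Gamma(\lambda+1)}{}_2\mathbf F_1\bigl(-\lambda,2\mu+\lambda;\mu+\tfrac12;\tfrac{1-z}2\bigr)$. Jacobi function of the second kind ($z\in\mathbb C\setminus[-1,1]$, $\alpha+\gamma,\beta+\gamma\notin-\mathbb N$): $Q_\gamma^{(\alpha,\beta)}(z)=\frac{2^{\alpha+\beta+\gamma}\Gamma(\alpha+\gamma+1)\Gamma(\beta+\gamma+1)}{(z-1)^{\alpha+\gamma+1}(z+1)^\beta}{}_2\mathbf F_1\bigl(\gamma+1,\alpha+\gamma+1;\alpha+\beta+2\gamma+2;\tfrac2{1-z}\bigr)$.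
   Formalization: The formulas are proved literally for Re z > 0; for other |z|<1 the right side means its analytic continuation from there (Q is undefined at Re z = 0, and for Re z < 0 the formula fails, e.g. γ=0, β=1). The conditions under which C and Q are defined are assumed for each formula. *)

theory Defs
  imports "HOL-Complex_Analysis.Complex_Analysis"
begin

text \<open>
  Olver's normalized Gauss hypergeometric function: the analytic continuation of the series
  from the unit disc to the plane cut along \<open>[1,\<infinity>)\<close>. The continuation is unique because the
  cut plane is connected; on the cut itself the value is unspecified. Writing the coefficients
  with \<^const>\<open>rGamma\<close> gives \<open>1 / \<Gamma>(c + k) = 0\<close> at the poles of \<open>\<Gamma>\<close>, so every \<open>c\<close> is allowed.
\<close>

definition olver_2F1 :: "complex \<Rightarrow> complex \<Rightarrow> complex \<Rightarrow> complex \<Rightarrow> complex" where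
  "olver_2F1 a b c z =
     (THE v. \<exists>f. f holomorphic_on (- (complex_of_real ` {1..})) \<and>
        (\<forall>u. cmod u < 1 \<longrightarrow>
           (\<lambda>k. pochhammer a k * pochhammer b k * rGamma (c + of_nat k) * (u ^ k / fact k))
             sums f u) \<and>
        v = f z)"

definition gegenbauer_admissible :: "complex \<Rightarrow> complex \<Rightarrow> bool" where
  "gegenbauer_admissible l m \<longleftrightarrow> l + 2 * m \<notin> \<int>\<^sub>\<le>\<^sub>0"

definition gegenbauer_C :: "complex \<Rightarrow> complex \<Rightarrow> complex \<Rightarrow> complex" where
  "gegenbauer_C l m z =
     of_real (sqrt pi) * Gamma (l + 2 * m) / 2 powr (2 * m - 1) * rGamma m * rGamma (l + 1) *
     olver_2F1 (- l) (2 * m + l) (m + 1 / 2) ((1 - z) / 2)"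

text \<open>
  The conditions \<open>\<alpha> + \<gamma>, \<beta> + \<gamma> \<notin> {-1, -2, ...}\<close>, shifted by one.
\<close>

definition jacobi_Q_admissible :: "complex \<Rightarrow> complex \<Rightarrow> complex \<Rightarrow> bool" where
  "jacobi_Q_admissible \<gamma> \<alpha> \<beta> \<longleftrightarrow> \<alpha> + \<gamma> + 1 \<notin> \<int>\<^sub>\<le>\<^sub>0 \<and> \<beta> + \<gamma> + 1 \<notin> \<int>\<^sub>\<le>\<^sub>0"

text \<open>
  Meaningful for \<open>z\<close> outside the real segment \<open>[-1,1]\<close>; complex powers are principal values.
\<close>

definition jacobi_Q :: "complex \<Rightarrow> complex \<Rightarrow> complex \<Rightarrow> complex \<Rightarrow> complex" where
  "jacobi_Q \<gamma> \<alpha> \<beta> z =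
     2 powr (\<alpha> + \<beta> + \<gamma>) * Gamma (\<alpha> + \<gamma> + 1) * Gamma (\<beta> + \<gamma> + 1) /
       ((z - 1) powr (\<alpha> + \<gamma> + 1) * (z + 1) powr \<beta>) *
     olver_2F1 (\<gamma> + 1) (\<alpha> + \<gamma> + 1) (\<alpha> + \<beta> + 2 * \<gamma> + 2) (2 / (1 - z))"

text \<open>
  \<open>F\<close> is the analytic continuation to the whole unit disc of the values of \<open>f\<close> on its right half.
  It is unique if it exists. An expression in \<open>Q ((1 + z\<^sup>2) / (1 - z\<^sup>2))\<close> needs this reading: the
  argument determines \<open>z\<close> only up to sign, and it lies in the excluded segment \<open>[-1,1]\<close> exactly
  when \<open>Re z = 0\<close> (for \<open>|z| < 1\<close>). Principal values give the branch with
  \<open>(z\<^sup>2) powr (1/2) = z\<close> on the half \<open>Re z > 0\<close>, and only there.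
\<close>

definition unit_disc_continuation :: "(complex \<Rightarrow> complex) \<Rightarrow> (complex \<Rightarrow> complex) \<Rightarrow> bool" where
  "unit_disc_continuation f F \<longleftrightarrow>
     F holomorphic_on ball 0 1 \<and> (\<forall>w\<in>ball 0 1. Re w > 0 \<longrightarrow> F w = f w)"

end

theory Submission
  imports Defs
begin

text \<open>
  Both formulas are the same quadratic transformation of the hypergeometric function. Write
  \<open>\<lambda>\<close> for the degree (\<open>2\<gamma> + 1\<close> or \<open>2\<gamma>\<close>) and \<open>c = \<beta> + 1/2\<close>. At \<open>x = (1 + w\<^sup>2)/(1 - w\<^sup>2)\<close> one has
  \<open>x - 1 = 2w\<^sup>2/(1 - w\<^sup>2)\<close>, \<open>x + 1 = 2/(1 - w\<^sup>2)\<close> and \<open>2/(1 - x) = 1 - 1/w\<^sup>2\<close>, so in the right half of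
  the unit disc all powers of \<open>1 - w\<^sup>2\<close> cancel, and by Legendre's duplication formula the claim becomes

  \<open>F(-\<lambda>, 2c - 1 + \<lambda>; c; (1 - w)/2) = w powr \<lambda> * F(-\<lambda>/2, (1 - \<lambda>)/2; c; 1 - 1/w\<^sup>2)\<close> for \<open>Re w > 0\<close>

  (\<open>olver_2F1_quadratic_transformation\<close>). The left-hand side is holomorphic in the whole disc, so
  the Gegenbauer function itself is the required continuation.

  The transformation is proved for the formal power series in \<open>s = (1 - w)/2\<close>: both sides solve the
  hypergeometric equation with the same value at \<open>0\<close>, which determines a power series solution
  unless \<open>c\<close> is a nonpositive integer; those \<open>c\<close> follow because every coefficient is continuous
  in \<open>c\<close>. The identity theorem carries it to the half plane.

  What makes these manipulations meaningful is that Olver's function exists, that is, that its series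
  extends to the plane cut along \<open>[1,\<infinity>)\<close> for all parameters (\<open>extends_to_cut_plane_olver_fps\<close>).
  This comes from Euler's integral: multiplying the coefficients of a series \<open>f\<close> by the Beta values
  \<open>B(p + k, q)\<close> gives \<open>\<integral> t powr (p - 1) * (1 - t) powr (q - 1) * f(z * t) dt\<close> over \<open>[0,1]\<close>, and the
  cut plane is star-shaped about \<open>0\<close>. Starting from \<open>(1 - z) powr (-a)\<close> this yields the series when
  the real parts of \<open>b\<close> and \<open>c - b\<close> are large. Discarding finitely many terms of a series enlarges \<open>b\<close>,
  and a first order differential operator lowers \<open>c\<close> by \<open>1\<close>; neither affects extendability.
\<close>

section \<open>Power series that extend to the cut plane\<close>

definition cut_plane :: "complex set" where
  "cut_plane = - (complex_of_real ` {1..})"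

lemma mem_cut_plane: "z \<in> cut_plane \<longleftrightarrow> Im z \<noteq> 0 \<or> Re z < 1"
  by (auto simp: cut_plane_def image_iff complex_eq_iff not_le)

lemma open_cut_plane: "open cut_plane"
proof -
  have *: "cut_plane = {z. Im z \<noteq> 0} \<union> {z. Re z < 1}"
    by (auto simp: mem_cut_plane)
  show ?thesis
    unfolding * by (intro open_Un open_halfspace_Re_lt open_Collect_neq continuous_intros)
qed

lemma zero_in_cut_plane: "0 \<in> cut_plane"
  by (simp add: mem_cut_plane)

lemma ball_subset_cut_plane: "ball 0 1 \<subseteq> cut_plane"
proof
  fix z :: complex assume "z \<in> ball 0 1"
  thus "z \<in> cut_plane"
    using complex_Re_le_cmod[of z] by (simp add: mem_cut_plane)
qed

lemma cut_plane_scale: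
  assumes "z \<in> cut_plane" "0 \<le> t" "t \<le> 1"
  shows "z * of_real t \<in> cut_plane"
proof (cases "t = 0")
  case False
  have "Re z * t < 1" if "Re z < 1"
  proof (cases "Re z \<le> 0")
    case True
    thus ?thesis using mult_nonpos_nonneg[OF True assms(2)] by linarith
  next
    case F: False
    have "Re z * t \<le> Re z * 1" using F assms by (intro mult_left_mono) auto
    thus ?thesis using that by simp
  qed
  thus ?thesis using assms False by (auto simp: mem_cut_plane)
qed (simp add: mem_cut_plane)

lemma connected_cut_plane: "connected cut_plane"
proof -
  have "closed_segment 0 z \<subseteq> cut_plane" if "z \<in> cut_plane" for z
  proof
    fix x assume "x \<in> closed_segment 0 z"
    then obtain u where "0 \<le> u" "u \<le> 1" "x = z * of_real u"
      by (auto simp: closed_segment_def scaleR_conv_of_real)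
    thus "x \<in> cut_plane" using cut_plane_scale that by simp
  qed
  hence "starlike cut_plane"
    unfolding starlike_def using zero_in_cut_plane by blast
  thus ?thesis by (rule starlike_imp_connected)
qed

definition extends_to_cut_plane :: "complex fps \<Rightarrow> bool" where
  "extends_to_cut_plane F \<longleftrightarrow> (\<exists>f. f holomorphic_on cut_plane \<and> f has_fps_expansion F)"

lemma extends_to_cut_plane_const: "extends_to_cut_plane (fps_const c)"
  unfolding extends_to_cut_plane_def
  by (rule exI[of _ "\<lambda>_. c"]) (auto intro: fps_expansion_intros)

lemma extends_to_cut_plane_X: "extends_to_cut_plane fps_X"
  unfolding extends_to_cut_plane_def
  by (rule exI[of _ "\<lambda>x. x"]) (auto intro: fps_expansion_intros)

lemma extends_to_cut_plane_add:
  "extends_to_cut_plane F \<Longrightarrow> extends_to_cut_plane G \<Longrightarrow> extends_to_cut_plane (F + G)"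
  unfolding extends_to_cut_plane_def by (blast intro: holomorphic_intros fps_expansion_intros)

lemma extends_to_cut_plane_mult:
  "extends_to_cut_plane F \<Longrightarrow> extends_to_cut_plane G \<Longrightarrow> extends_to_cut_plane (F * G)"
  unfolding extends_to_cut_plane_def by (blast intro: holomorphic_intros fps_expansion_intros)

lemma extends_to_cut_plane_deriv:
  "extends_to_cut_plane F \<Longrightarrow> extends_to_cut_plane (fps_deriv F)"
  unfolding extends_to_cut_plane_def
  by (blast intro: holomorphic_deriv open_cut_plane fps_expansion_intros)

text \<open>
  Removing the constant term and dividing by \<open>z\<close> leaves a removable singularity at \<open>0\<close>.
\<close>

lemma extends_to_cut_plane_shift_iff:
  "extends_to_cut_plane (fps_shift 1 F) \<longleftrightarrow> extends_to_cut_plane F"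
proof
  assume "extends_to_cut_plane (fps_shift 1 F)"
  hence "extends_to_cut_plane (fps_const (fps_nth F 0) + fps_X * fps_shift 1 F)"
    by (intro extends_to_cut_plane_add extends_to_cut_plane_mult
          extends_to_cut_plane_const extends_to_cut_plane_X)
  also have "fps_const (fps_nth F 0) + fps_X * fps_shift 1 F = F"
    by (rule fps_ext) simp
  finally show "extends_to_cut_plane F" .
next
  assume F: "extends_to_cut_plane F"
  show "extends_to_cut_plane (fps_shift 1 F)"
  proof (cases "F = fps_const (fps_nth F 0)")
    \<comment> \<open>A constant series is split off because \<open>F - F(0)\<close> then has subdegree \<open>0\<close> by convention.\<close>
    case True
    hence "fps_shift 1 F = fps_const 0"
      by (auto simp: fps_eq_iff)
    thus ?thesis using extends_to_cut_plane_const by metis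
  next
    case False
    from F obtain f where f: "f holomorphic_on cut_plane" "f has_fps_expansion F"
      by (auto simp: extends_to_cut_plane_def)
    have f0: "f 0 = fps_nth F 0"
      using has_fps_expansion_imp_0_eq_fps_nth_0[OF f(2)] by simp
    have d: "deriv f 0 = fps_nth F 1"
      using has_fps_expansion_imp_0_eq_fps_nth_0[OF has_fps_expansion_deriv[OF f(2)]] by simp
    let ?g = "\<lambda>z. if z = 0 then deriv f 0 else (f z - f 0) / (z - 0)"
    have "?g holomorphic_on cut_plane"
      by (rule pole_lemma_open[OF f(1) open_cut_plane])
    moreover have "?g has_fps_expansion fps_shift 1 F"
    proof -
      have "(\<lambda>z. f z - f 0) has_fps_expansion (F - fps_const (f 0))"
        by (intro fps_expansion_intros f)
      hence "(\<lambda>x. if x = 0 then deriv f 0 else (f x - f 0) / x ^ 1) has_fps_expansion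
               fps_shift 1 (F - fps_const (f 0))"
        by (rule has_fps_expansion_shift)
           (use False in \<open>auto simp: f0 d intro!: subdegree_geI\<close>)
      also have "fps_shift 1 (F - fps_const (f 0)) = fps_shift 1 F"
        by (rule fps_ext) simp
      finally show ?thesis by (simp only: diff_zero power_one_right)
    qed
    ultimately show ?thesis
      unfolding extends_to_cut_plane_def by blast
  qed
qed

lemma extends_to_cut_plane_shift_n_iff:
  "extends_to_cut_plane (fps_shift n F) \<longleftrightarrow> extends_to_cut_plane F"
proof (induction n)
  case (Suc n)
  have "fps_shift (Suc n) F = fps_shift 1 (fps_shift n F)"
    by (rule fps_ext) simp
  thus ?case using Suc extends_to_cut_plane_shift_iff by metis
qed simp

lemma extends_to_cut_plane_binomial:
  "extends_to_cut_plane (Abs_fps (\<lambda>k. pochhammer a k / fact k))"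
proof -
  have "(\<lambda>z. (1 - z) powr (- a)) holomorphic_on cut_plane"
    by (intro holomorphic_intros) (auto simp: mem_cut_plane complex_nonpos_Reals_iff)
  moreover have "(\<lambda>z. (1 - z) powr (- a)) has_fps_expansion Abs_fps (\<lambda>k. pochhammer a k / fact k)"
  proof (rule has_fps_expansionI)
    have "eventually (\<lambda>u::complex. u \<in> ball 0 1) (nhds 0)"
      by (intro eventually_nhds_in_open) auto
    thus "eventually (\<lambda>u. (\<lambda>n. fps_nth (Abs_fps (\<lambda>k. pochhammer a k / fact k)) n * u ^ n)
            sums ((1 - u) powr (- a))) (nhds 0)"
    proof eventually_elim
      case (elim u)
      have "(\<lambda>n. ((- a) gchoose n) * (- u) ^ n) sums (1 + (- u)) powr (- a)"
        by (rule gen_binomial_complex) (use elim in auto)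
      moreover have "((- a) gchoose n) * (- u) ^ n = pochhammer a n / fact n * u ^ n" for n
        by (simp add: gbinomial_pochhammer power_minus[of u n])
      ultimately show ?case by simp
    qed
  qed
  ultimately show ?thesis unfolding extends_to_cut_plane_def by blast
qed

section \<open>The Beta integral with complex parameters\<close>

definition beta_weight :: "complex \<Rightarrow> complex \<Rightarrow> real \<Rightarrow> complex" where
  "beta_weight p q t = of_real t powr (p - 1) * of_real (1 - t) powr (q - 1)"

lemma continuous_on_powr_unit_interval:
  assumes "Re p > 0"
  shows "continuous_on {0..1} (\<lambda>t. complex_of_real t powr p)"
  by (rule continuous_on_powr_complex) (use assms in \<open>auto intro!: continuous_intros\<close>)

lemma continuous_on_beta_weight:
  assumes "Re p > 1" "Re q > 1"
  shows "continuous_on {0..1} (beta_weight p q)"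
proof -
  have "continuous_on {0..1} (\<lambda>t. complex_of_real t powr (p - 1))"
    using assms by (intro continuous_on_powr_unit_interval) auto
  moreover have "continuous_on {0..1} (\<lambda>t. complex_of_real (1 - t) powr (q - 1))"
    by (rule continuous_on_powr_complex) (use assms in \<open>auto intro!: continuous_intros\<close>)
  ultimately show ?thesis
    unfolding beta_weight_def by (rule continuous_on_mult)
qed

text \<open>
  Since \<open>ln 0 = 0\<close>, the function is \<open>0\<close> at the left end point, which is also its limit there.
\<close>

lemma continuous_on_mult_ln: "continuous_on {0..1} (\<lambda>t::real. t * ln t)"
proof -
  have "continuous (at t within {0..1}) (\<lambda>t::real. t * ln t)" if "t \<in> {0..1}" for t
  proof (cases "t = 0")
    case True
    have "((\<lambda>t::real. t * ln t) \<longlongrightarrow> 0) (at_right 0)" by real_asymp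
    hence "((\<lambda>t::real. t * ln t) \<longlongrightarrow> 0) (at 0 within {0..1})"
      by (simp add: at_within_Icc_at_right)
    thus ?thesis by (simp add: continuous_within True)
  next
    case False
    hence "isCont (\<lambda>t. t * ln t) t"
      by (intro isCont_mult isCont_ln continuous_ident)
    thus ?thesis by (rule continuous_at_imp_continuous_within)
  qed
  thus ?thesis by (simp add: continuous_on_eq_continuous_within)
qed

text \<open>
  The derivative of the integrand in \<open>p\<close> contains \<open>ln t * t powr (p - 1)\<close>. For \<open>Re p > 2\<close> it can be
  written as \<open>(t * ln t) * t powr (p - 2)\<close>, a product of functions that are continuous up to \<open>t = 0\<close>,
  so differentiation under the integral sign needs no improper integrals.
\<close>

lemma holomorphic_on_mellin_unit_interval:
  assumes g: "continuous_on {0..1} g"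
  shows "(\<lambda>p. integral {0..1} (\<lambda>t. complex_of_real t powr (p - 1) * g t)) holomorphic_on {p. Re p > 2}"
proof -
  let ?U = "{p::complex. Re p > 2}"
  let ?f' = "\<lambda>p t. of_real (t * ln t) * complex_of_real t powr (p - 2) * g t"
  have "(\<lambda>p. integral (cbox 0 1) (\<lambda>t. complex_of_real t powr (p - 1) * g t)) holomorphic_on ?U"
  proof (rule leibniz_rule_holomorphic[where fx = ?f'])
    fix p t assume p: "p \<in> ?U" and t: "t \<in> cbox 0 (1::real)"
    show "((\<lambda>p. complex_of_real t powr (p - 1) * g t) has_field_derivative ?f' p t) (at p within ?U)"
    proof (cases "t = 0")
      case False
      have "of_real t powr (p - 1) = of_real t * complex_of_real t powr (p - 2)"
        using False powr_add[of "complex_of_real t" 1 "p - 2"] by simp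
      moreover have "((\<lambda>p. complex_of_real t powr (p - 1)) has_field_derivative
                       Ln (of_real t) * of_real t powr (p - 1) * 1) (at p within ?U)"
        using False
        by (intro DERIV_chain2[where g = "\<lambda>p. p - 1" and f = "\<lambda>p. of_real t powr p"]
              has_field_derivative_powr_right) (auto intro!: derivative_eq_intros)
      hence "((\<lambda>p. complex_of_real t powr (p - 1) * g t) has_field_derivative
               Ln (of_real t) * of_real t powr (p - 1) * 1 * g t) (at p within ?U)"
        by (rule DERIV_cmult_right)
      ultimately show ?thesis using False t by (simp add: Ln_of_real mult_ac)
    qed simp
  next
    fix p assume p: "p \<in> ?U"
    show "(\<lambda>t. complex_of_real t powr (p - 1) * g t) integrable_on cbox 0 1"
      using p by (intro integrable_continuous continuous_on_mult g[folded box_real]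
                    continuous_on_powr_unit_interval[folded box_real]) auto
  next
    have "continuous_on (?U \<times> {0..1}) (\<lambda>x. complex_of_real (snd x) powr (fst x - 2))"
      by (rule continuous_on_powr_complex) (auto intro!: continuous_intros)
    moreover have "continuous_on (?U \<times> {0..1}) (\<lambda>x. complex_of_real (snd x * ln (snd x)))"
      by (intro continuous_on_of_real continuous_on_compose2[OF continuous_on_mult_ln])
         (auto intro!: continuous_intros)
    moreover have "continuous_on (?U \<times> {0..1}) (\<lambda>x. g (snd x))"
      by (intro continuous_on_compose2[OF g]) (auto intro!: continuous_intros)
    ultimately show "continuous_on (?U \<times> cbox 0 1) (\<lambda>(p, t). ?f' p t)"
      unfolding case_prod_unfold box_real by (intro continuous_on_mult)
  qed (rule convex_halfspace_Re_gt)
  thus ?thesis by simp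
qed

lemma eq_on_half_plane_if_eq_on_reals:
  assumes f: "f holomorphic_on {p. Re p > a}" and g: "g holomorphic_on {p. Re p > a}"
    and eq: "\<And>x::real. x > a \<Longrightarrow> f (of_real x) = g (of_real x)" and p: "Re p > a"
  shows "f p = g p"
proof -
  let ?U = "complex_of_real ` {a<..}"
  have "f p - g p = 0"
  proof (rule analytic_continuation[where f = "\<lambda>p. f p - g p" and U = ?U and S = "{p. Re p > a}" and \<xi> = "of_real (a + 1)"])
    show "(\<lambda>p. f p - g p) holomorphic_on {p. Re p > a}"
      using f g by (intro holomorphic_intros)
    show "complex_of_real (a + 1) islimpt ?U"
    proof -
      have "(a + 1) islimpt {a<..}"
        by (intro interior_limit_point) (auto simp: interior_open)
      then obtain r where "\<And>n. r n \<in> {a<..} - {a + 1}" "r \<longlonglongrightarrow> a + 1"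
        unfolding islimpt_sequential by blast
      thus ?thesis
        unfolding islimpt_sequential
        by (intro exI[of _ "\<lambda>n. of_real (r n)"]) (auto intro!: tendsto_of_real simp del: of_real_add)
    qed
  qed (use p eq in \<open>auto intro: open_halfspace_Re_gt convex_connected convex_halfspace_Re_gt\<close>)
  thus ?thesis by simp
qed

lemma integral_beta_weight_commute:
  "integral {0..1} (beta_weight p q) = integral {0..1} (beta_weight q p)"
proof -
  let ?g = "\<lambda>t. beta_weight q p (- t)"
  have "integral {0..1} (beta_weight p q) = integral {0..1} (\<lambda>t. ?g (t + (-1)))"
    by (intro integral_cong) (simp add: beta_weight_def mult.commute)
  also have "\<dots> = integral {-1..0} ?g"
    using integral_shift_real_ivl[of "-1" "-1" 0 ?g] by simp
  also have "\<dots> = integral {0..1} (beta_weight q p)"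
    using Henstock_Kurzweil_Integration.integral_reflect_real[of 1 0 "beta_weight q p"] by simp
  finally show ?thesis .
qed

text \<open>
  The formula is known for real parameters. Both sides are holomorphic in each parameter, so the
  identity theorem makes first \<open>p\<close> and then, by the symmetry \<open>t \<mapsto> 1 - t\<close>, also \<open>q\<close> complex.
\<close>

lemma integral_beta_weight:
  assumes "Re p > 2" "Re q > 2"
  shows "integral {0..1} (beta_weight p q) = Beta p q"
proof -
  have hol: "(\<lambda>p. integral {0..1} (beta_weight p q)) holomorphic_on {p. Re p > 2}" if "Re q > 2" for q
    unfolding beta_weight_def
    by (rule holomorphic_on_mellin_unit_interval, rule continuous_on_powr_complex)
       (use that in \<open>auto intro!: continuous_intros\<close>)
  have notin: "s \<notin> \<int>\<^sub>\<le>\<^sub>0" if "Re s > 2" for s :: complex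
    using that by (auto elim!: nonpos_Ints_cases)
  have holB: "(\<lambda>p. Beta p q) holomorphic_on {p. Re p > 2}" if "Re q > 2" for q
    unfolding Beta_altdef
    by (intro holomorphic_intros) (use that notin in auto)
  have rr: "integral {0..1} (beta_weight (of_real x) (of_real y)) = Beta (of_real x) (of_real y)"
    if "x > 2" "y > 2" for x y :: real
  proof -
    have "((\<lambda>t. t powr (x - 1) * (1 - t) powr (y - 1)) has_integral Beta x y) {0..1}"
      using that by (intro has_integral_Beta_real) auto
    hence "((\<lambda>t. complex_of_real (t powr (x - 1) * (1 - t) powr (y - 1))) has_integral of_real (Beta x y)) {0..1}"
      by (rule has_integral_of_real)
    also have "?this \<longleftrightarrow> (beta_weight (of_real x) (of_real y) has_integral of_real (Beta x y)) {0..1}"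
    proof (rule has_integral_cong)
      fix t :: real assume "t \<in> {0..1}"
      thus "of_real (t powr (x - 1) * (1 - t) powr (y - 1)) = beta_weight (of_real x) (of_real y) t"
        using powr_of_real[of t "x - 1"] powr_of_real[of "1 - t" "y - 1"]
        by (simp add: beta_weight_def)
    qed
    finally show ?thesis by (simp add: integral_unique Beta_complex_of_real)
  qed
  have cr: "integral {0..1} (beta_weight p (of_real y)) = Beta p (of_real y)"
    if "Re p > 2" "y > 2" for p and y :: real
    by (rule eq_on_half_plane_if_eq_on_reals[OF hol holB]) (use that rr in auto)
  have "integral {0..1} (beta_weight q p) = Beta q p"
    by (rule eq_on_half_plane_if_eq_on_reals[OF hol holB])
       (use assms cr integral_beta_weight_commute Beta_commute in auto)
  thus ?thesis using integral_beta_weight_commute[of p q] Beta_commute[of p q] by simp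
qed

text \<open>
  Euler's integral as an operation on power series: the extension is
  \<open>\<integral> t powr (p - 1) * (1 - t) powr (q - 1) * f(z * t) dt\<close> over \<open>[0,1]\<close>, where \<open>f\<close> extends the given
  series. It is defined on the cut plane because that contains \<open>z * t\<close> together with \<open>z\<close>, and near
  \<open>0\<close> the integration can be carried out term by term.
\<close>

lemma extends_to_cut_plane_Beta_multiplier:
  assumes F: "extends_to_cut_plane F" and p: "Re p > 2" and q: "Re q > 2"
  shows "extends_to_cut_plane (Abs_fps (\<lambda>k. Beta (p + of_nat k) q * fps_nth F k))"
proof -
  obtain f where f: "f holomorphic_on cut_plane" "f has_fps_expansion F"
    using F by (auto simp: extends_to_cut_plane_def)
  let ?w = "beta_weight p q"
  have w: "continuous_on {0..1} ?w"
    using p q by (intro continuous_on_beta_weight) auto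
  define h where "h = (\<lambda>z. integral (cbox 0 1) (\<lambda>t. ?w t * f (z * of_real t)))"
  have h1: "h holomorphic_on U" if U: "convex U" "open U" "U \<subseteq> cut_plane" for U
    unfolding h_def
    \<comment> \<open>The Leibniz rule asks for a convex domain, which the cut plane is not; balls suffice.\<close>
  proof (rule leibniz_rule_holomorphic[where fx = "\<lambda>z t. ?w t * (deriv f (z * of_real t) * of_real t)"])
    fix z t assume z: "z \<in> U" and t: "t \<in> cbox 0 (1::real)"
    have "z * of_real t \<in> cut_plane"
      using cut_plane_scale z t U by auto
    hence "(f has_field_derivative deriv f (z * of_real t)) (at (z * of_real t))"
      by (rule holomorphic_derivI[OF f(1) open_cut_plane])
    hence "((\<lambda>z. f (z * of_real t)) has_field_derivative deriv f (z * of_real t) * of_real t) (at z within U)"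
      by (rule DERIV_chain2[where g = "\<lambda>z. z * of_real t"]) (auto intro!: derivative_eq_intros)
    thus "((\<lambda>z. ?w t * f (z * of_real t)) has_field_derivative
            ?w t * (deriv f (z * of_real t) * of_real t)) (at z within U)"
      by (rule DERIV_cmult)
  next
    fix z assume z: "z \<in> U"
    show "(\<lambda>t. ?w t * f (z * of_real t)) integrable_on cbox 0 1"
      using z U cut_plane_scale w
      by (intro integrable_continuous continuous_on_mult
            continuous_on_compose2[OF holomorphic_on_imp_continuous_on[OF f(1)]])
         (auto intro!: continuous_intros)
  next
    have "deriv f holomorphic_on cut_plane"
      by (rule holomorphic_deriv[OF f(1) open_cut_plane])
    hence "continuous_on cut_plane (deriv f)" by (rule holomorphic_on_imp_continuous_on)
    hence "continuous_on (U \<times> {0..1}) (\<lambda>x. deriv f (fst x * of_real (snd x)))"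
      by (rule continuous_on_compose2) (use U cut_plane_scale in \<open>auto intro!: continuous_intros\<close>)
    moreover have "continuous_on (U \<times> {0..1}) (\<lambda>x. ?w (snd x))"
      by (rule continuous_on_compose2[OF w]) (auto intro!: continuous_intros)
    ultimately show "continuous_on (U \<times> cbox 0 1) (\<lambda>(z, t). ?w t * (deriv f (z * of_real t) * of_real t))"
      unfolding case_prod_unfold box_real by (intro continuous_intros)
  qed (use U in auto)
  have "h holomorphic_on cut_plane"
  proof (rule analytic_imp_holomorphic, unfold analytic_on_def, rule ballI)
    fix z assume "z \<in> cut_plane"
    then obtain e where "e > 0" "ball z e \<subseteq> cut_plane"
      using open_cut_plane open_contains_ball by blast
    thus "\<exists>e>0. h holomorphic_on ball z e"
      using h1[of "ball z e"] by auto
  qed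
  moreover have "h has_fps_expansion Abs_fps (\<lambda>k. Beta (p + of_nat k) q * fps_nth F k)"
  proof (rule has_fps_expansionI)
    have holf: "f holomorphic_on eball 0 1"
      using holomorphic_on_subset[OF f(1)] ball_subset_cut_plane by (simp add: one_ereal_def)
    have sums: "(\<lambda>k. fps_nth F k * z ^ k) sums f z" if "norm z < 1" for z
      using has_fps_expansion_imp_sums_complex[OF f(2) holf] that by (simp add: one_ereal_def)
    have "eventually (\<lambda>u::complex. u \<in> ball 0 1) (nhds 0)"
      by (intro eventually_nhds_in_open) auto
    thus "eventually (\<lambda>u. (\<lambda>n. fps_nth (Abs_fps (\<lambda>k. Beta (p + of_nat k) q * fps_nth F k)) n * u ^ n) sums h u) (nhds 0)"
    proof eventually_elim
      case (elim z)
      hence z: "norm z < 1" by simp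
      have "bounded (?w ` {0..1})"
        by (intro compact_imp_bounded compact_continuous_image w) auto
      then obtain W where W: "\<And>t. t \<in> {0..1} \<Longrightarrow> norm (?w t) \<le> W"
        unfolding bounded_iff by blast
      let ?g = "\<lambda>k t. ?w t * (fps_nth F k * (z * of_real t) ^ k)"
      have int: "integral {0..1} (?g k) = Beta (p + of_nat k) q * fps_nth F k * z ^ k" for k
      proof -
        have "integral {0..1} (?g k) = integral {0..1} (\<lambda>t. fps_nth F k * z ^ k * beta_weight (p + of_nat k) q t)"
        proof (rule integral_cong)
          fix t :: real assume "t \<in> {0..1}"
          show "?g k t = fps_nth F k * z ^ k * beta_weight (p + of_nat k) q t"
          proof (cases "t = 0")
            case False
            hence "of_real t powr (p + of_nat k - 1) = of_real t powr (p - 1) * complex_of_real t ^ k"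
              using powr_add[of "complex_of_real t" "p - 1" "of_nat k"]
              by (simp add: powr_nat' algebra_simps)
            thus ?thesis by (simp add: beta_weight_def power_mult_distrib)
          qed (simp add: beta_weight_def)
        qed
        also have "\<dots> = fps_nth F k * z ^ k * Beta (p + of_nat k) q"
          using integral_beta_weight[of "p + of_nat k" q] p q by simp
        finally show ?thesis by (simp add: mult_ac)
      qed
      have "uniform_limit {0..1} (\<lambda>n t. \<Sum>k<n. ?g k t) (\<lambda>t. \<Sum>k. ?g k t) sequentially"
      proof (rule Weierstrass_m_test)
        show "norm (?g k t) \<le> W * norm (fps_nth F k * z ^ k)" if "t \<in> {0..1}" for k t
        proof -
          have "norm (fps_nth F k * (z * of_real t) ^ k) = norm (fps_nth F k * z ^ k) * t ^ k"
            using that by (simp add: norm_mult norm_power power_mult_distrib)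
          also have "\<dots> \<le> norm (fps_nth F k * z ^ k) * 1"
            using that by (intro mult_left_mono power_le_one) auto
          finally show ?thesis using W[OF that]
            by (subst norm_mult) (intro mult_mono, auto intro: order_trans[OF norm_ge_zero])
        qed
        have "summable (\<lambda>k. norm (fps_nth F k * z ^ k))"
        proof (rule abs_summable_in_conv_radius)
          have "conv_radius (fps_nth F) \<ge> 1"
            using holomorphic_on_imp_fps_conv_radius_ge[OF f(2) holf] by (simp add: fps_conv_radius_def)
          thus "ereal (norm z) < conv_radius (fps_nth F)"
            using z by (metis ereal_less(3) less_le_trans)
        qed
        thus "summable (\<lambda>k. W * norm (fps_nth F k * z ^ k))" by (rule summable_mult)
      qed
      also have "?this \<longleftrightarrow> uniform_limit {0..1} (\<lambda>n t. \<Sum>k<n. ?g k t) (\<lambda>t. ?w t * f (z * of_real t)) sequentially"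
      proof (rule uniform_limit_cong')
        fix t :: real assume t: "t \<in> {0..1}"
        have "norm (z * of_real t) \<le> norm z * 1"
          unfolding norm_mult using t by (intro mult_left_mono) auto
        hence "(\<lambda>k. ?g k t) sums (?w t * f (z * of_real t))"
          using z by (intro sums_mult sums) simp
        thus "(\<Sum>k. ?g k t) = ?w t * f (z * of_real t)"
          by (simp add: sums_iff)
      qed auto
      finally have ul: "uniform_limit {0..1} (\<lambda>n t. \<Sum>k<n. ?g k t) (\<lambda>t. ?w t * f (z * of_real t)) sequentially" .
      have cont: "continuous_on {0..1} (?g k)" for k
        by (intro continuous_intros w)
      obtain I J where IJ: "\<And>n. ((\<lambda>t. \<Sum>k<n. ?g k t) has_integral I n) {0..1}"
          "((\<lambda>t. ?w t * f (z * of_real t)) has_integral J) {0..1}" "I \<longlonglongrightarrow> J"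
        by (rule uniform_limit_integral[OF ul]) (auto intro: continuous_on_sum cont)
      have "I = (\<lambda>n. \<Sum>k<n. integral {0..1} (?g k))"
      proof
        fix n
        show "I n = (\<Sum>k<n. integral {0..1} (?g k))"
        by (intro has_integral_unique[OF IJ(1)] has_integral_sum integrable_integral
              integrable_continuous_interval cont) auto
      qed
      moreover have "J = h z"
        using IJ(2) by (simp add: h_def integral_unique)
      ultimately show ?case using IJ(3) by (simp add: sums_def int)
    qed
  qed
  ultimately show ?thesis unfolding extends_to_cut_plane_def by blast
qed

section \<open>Olver's hypergeometric function on the cut plane\<close>

definition olver_fps :: "complex \<Rightarrow> complex \<Rightarrow> complex \<Rightarrow> complex fps" where
  "olver_fps a b c = Abs_fps (\<lambda>k. pochhammer a k * pochhammer b k * rGamma (c + of_nat k) / fact k)"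

text \<open>
  Up to a constant factor, the quotient \<open>(b)\<^sub>k / \<Gamma>(c + k)\<close> is \<open>B(b + k, c - b)\<close>, so Euler's integral
  applies to \<open>(1 - z) powr (-a)\<close>. After dropping \<open>N\<close> terms on both sides the first Beta parameter is
  \<open>b + N\<close> instead of \<open>b\<close>; hence \<open>b\<close> is arbitrary, and only \<open>c - b\<close> has to be large.
\<close>

lemma extends_to_cut_plane_olver_fps_aux:
  assumes "Re (c - b) > 2"
  shows "extends_to_cut_plane (olver_fps a b c)"
proof -
  obtain N :: nat where N: "real N > 2 - Re b" using reals_Archimedean2 by blast
  define G where "G = fps_shift N (Abs_fps (\<lambda>k. pochhammer a k / fact k))"
  have "extends_to_cut_plane G"
    unfolding G_def extends_to_cut_plane_shift_n_iff by (rule extends_to_cut_plane_binomial)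
  hence "extends_to_cut_plane (Abs_fps (\<lambda>k. Beta (b + of_nat N + of_nat k) (c - b) * fps_nth G k))"
    by (rule extends_to_cut_plane_Beta_multiplier) (use N assms in auto)
  hence "extends_to_cut_plane (fps_const (pochhammer b N / (Gamma (b + of_nat N) * Gamma (c - b))) *
          Abs_fps (\<lambda>k. Beta (b + of_nat N + of_nat k) (c - b) * fps_nth G k))"
    by (intro extends_to_cut_plane_mult extends_to_cut_plane_const)
  also have "fps_const (pochhammer b N / (Gamma (b + of_nat N) * Gamma (c - b))) *
          Abs_fps (\<lambda>k. Beta (b + of_nat N + of_nat k) (c - b) * fps_nth G k) = fps_shift N (olver_fps a b c)"
  proof (rule fps_ext)
    fix k
    have 1: "b + of_nat N \<notin> \<int>\<^sub>\<le>\<^sub>0" "c - b \<notin> \<int>\<^sub>\<le>\<^sub>0"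
      using N assms by (auto elim!: nonpos_Ints_cases simp: complex_eq_iff)
    have 2: "Gamma (b + of_nat N + of_nat k) = Gamma (b + of_nat N) * pochhammer (b + of_nat N) k"
      using pochhammer_Gamma[OF 1(1), of k] 1 by (simp add: Gamma_eq_zero_iff)
    have 3: "pochhammer b (k + N) = pochhammer b N * pochhammer (b + of_nat N) k"
      using pochhammer_product'[of b N k] by (simp add: add.commute)
    have 4: "Beta (b + of_nat N + of_nat k) (c - b)
               = Gamma (b + of_nat N) * pochhammer (b + of_nat N) k * Gamma (c - b) * rGamma (c + of_nat (k + N))"
      unfolding Beta_altdef 2 by (simp add: algebra_simps)
    show "fps_nth (fps_const (pochhammer b N / (Gamma (b + of_nat N) * Gamma (c - b))) *
          Abs_fps (\<lambda>k. Beta (b + of_nat N + of_nat k) (c - b) * fps_nth G k)) k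
            = fps_nth (fps_shift N (olver_fps a b c)) k"
      unfolding fps_mult_left_const_nth fps_nth_Abs_fps 4 G_def olver_fps_def fps_shift_nth 3
      using 1 by (simp add: Gamma_eq_zero_iff)
  qed
  finally show ?thesis by (simp only: extends_to_cut_plane_shift_n_iff)
qed

text \<open>
  The operator \<open>c + z d/dz\<close> multiplies the \<open>k\<close>-th coefficient by \<open>c + k\<close>, and
  \<open>(c + k) / \<Gamma>(c + 1 + k) = 1 / \<Gamma>(c + k)\<close>. With Olver's normalization this holds for every \<open>c\<close>.
\<close>

lemma olver_fps_lower_c:
  "olver_fps a b c = fps_const c * olver_fps a b (c + 1) + fps_X * fps_deriv (olver_fps a b (c + 1))"
proof (rule fps_ext)
  fix k
  have *: "fps_nth (fps_const c * F + fps_X * fps_deriv F) k = (c + of_nat k) * fps_nth F k" for F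
    by (cases k) (simp_all add: algebra_simps)
  have "rGamma (c + of_nat k) = (c + of_nat k) * rGamma (c + 1 + of_nat k)"
    using rGamma_plus1[of "c + of_nat k"] by (simp add: add_ac)
  thus "fps_nth (olver_fps a b c) k = fps_nth (fps_const c * olver_fps a b (c + 1)
          + fps_X * fps_deriv (olver_fps a b (c + 1))) k"
    unfolding * by (simp add: olver_fps_def mult_ac)
qed

lemma extends_to_cut_plane_olver_fps: "extends_to_cut_plane (olver_fps a b c)"
proof -
  obtain M :: nat where M: "real M > 2 - Re (c - b)" using reals_Archimedean2 by blast
  have "extends_to_cut_plane (olver_fps a b (c + of_nat n)) \<Longrightarrow> extends_to_cut_plane (olver_fps a b c)" for n
  proof (induction n)
    case (Suc n)
    have "c + of_nat n + 1 = c + of_nat (Suc n)" by simp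
    hence "extends_to_cut_plane (olver_fps a b (c + of_nat n + 1))"
      using Suc.prems by (simp only:)
    hence "extends_to_cut_plane (olver_fps a b (c + of_nat n))"
      unfolding olver_fps_lower_c[of a b "c + of_nat n"]
      by (intro extends_to_cut_plane_add extends_to_cut_plane_mult extends_to_cut_plane_const
            extends_to_cut_plane_X extends_to_cut_plane_deriv)
    thus ?case by (rule Suc.IH)
  qed simp
  thus ?thesis using extends_to_cut_plane_olver_fps_aux[where c = "c + of_nat M" and b = b and a = a] M by simp
qed

text \<open>
  The definite description in \<open>olver_2F1\<close> is only meaningful because an extension exists; the
  identity theorem on the connected cut plane makes its value unique.
\<close>

lemma
  shows holomorphic_olver_2F1: "olver_2F1 a b c holomorphic_on cut_plane"
    and has_fps_expansion_olver_2F1: "olver_2F1 a b c has_fps_expansion olver_fps a b c"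
proof -
  obtain f where f: "f holomorphic_on cut_plane" "f has_fps_expansion olver_fps a b c"
    using extends_to_cut_plane_olver_fps unfolding extends_to_cut_plane_def by blast
  have coeff: "fps_nth (olver_fps a b c) k * u ^ k =
          pochhammer a k * pochhammer b k * rGamma (c + of_nat k) * (u ^ k / fact k)" for u k
    by (simp add: olver_fps_def)
  have "f holomorphic_on eball 0 1"
    using holomorphic_on_subset[OF f(1)] ball_subset_cut_plane by (simp add: one_ereal_def)
  hence sums: "(\<lambda>k. pochhammer a k * pochhammer b k * rGamma (c + of_nat k) * (u ^ k / fact k)) sums f u"
    if "norm u < 1" for u
    using has_fps_expansion_imp_sums_complex[OF f(2), of 1 u] that
    by (simp add: one_ereal_def coeff)
  have unique: "g z = f z"
    if g: "g holomorphic_on cut_plane"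
      "\<forall>u. norm u < 1 \<longrightarrow> (\<lambda>k. pochhammer a k * pochhammer b k * rGamma (c + of_nat k) * (u ^ k / fact k)) sums g u"
      and z: "z \<in> cut_plane" for g z
  proof -
    have "g has_fps_expansion olver_fps a b c"
    proof (rule has_fps_expansionI)
      have "eventually (\<lambda>u::complex. u \<in> ball 0 1) (nhds 0)"
        by (intro eventually_nhds_in_open) auto
      thus "eventually (\<lambda>u. (\<lambda>k. fps_nth (olver_fps a b c) k * u ^ k) sums g u) (nhds 0)"
        by eventually_elim (use g(2) coeff in auto)
    qed
    hence "(\<lambda>z. g z - f z) has_fps_expansion olver_fps a b c - olver_fps a b c"
      by (intro fps_expansion_intros f)
    hence "g z - f z = 0"
      by (intro has_fps_expansion_0_analytic_continuation[of "\<lambda>z. g z - f z" cut_plane])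
         (use g f z open_cut_plane connected_cut_plane zero_in_cut_plane in \<open>auto intro!: holomorphic_intros\<close>)
    thus ?thesis by simp
  qed
  have eq: "olver_2F1 a b c z = f z" if z: "z \<in> cut_plane" for z
    unfolding olver_2F1_def cut_plane_def[symmetric]
    by (rule the_equality) (use f sums unique z in blast)+
  show "olver_2F1 a b c holomorphic_on cut_plane"
    using f(1) eq by (simp cong: holomorphic_cong)
  have "eventually (\<lambda>z. z \<in> cut_plane) (nhds 0)"
    using open_cut_plane zero_in_cut_plane by (rule eventually_nhds_in_open)
  hence "eventually (\<lambda>z. olver_2F1 a b c z = f z) (nhds 0)"
    by eventually_elim (rule eq)
  thus "olver_2F1 a b c has_fps_expansion olver_fps a b c"
    using f(2) has_fps_expansion_cong by blast
qed

section \<open>The quadratic transformation\<close>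

definition satisfies_hypergeometric_ODE :: "complex \<Rightarrow> complex \<Rightarrow> complex \<Rightarrow> complex fps \<Rightarrow> bool" where
  "satisfies_hypergeometric_ODE a b c F \<longleftrightarrow>
     fps_X * (1 - fps_X) * fps_deriv (fps_deriv F)
       + (fps_const c - fps_const (a + b + 1) * fps_X) * fps_deriv F - fps_const (a * b) * F = 0"

text \<open>
  In this form a solution can be computed coefficient by coefficient as long as \<open>c + k\<close> never vanishes.
\<close>

lemma satisfies_hypergeometric_ODE_iff:
  "satisfies_hypergeometric_ODE a b c F \<longleftrightarrow>
     (\<forall>k. of_nat (Suc k) * (c + of_nat k) * fps_nth F (Suc k) = (a + of_nat k) * (b + of_nat k) * fps_nth F k)"
proof -
  have expand: "fps_X * (1 - fps_X) * fps_deriv (fps_deriv F)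
          + (fps_const c - fps_const (a + b + 1) * fps_X) * fps_deriv F - fps_const (a * b) * F =
        fps_X * fps_deriv (fps_deriv F) - fps_X * (fps_X * fps_deriv (fps_deriv F))
          + fps_const c * fps_deriv F - fps_const (a + b + 1) * (fps_X * fps_deriv F) - fps_const (a * b) * F"
    (is "_ = ?E") by (simp add: algebra_simps)
  have "fps_nth ?E k = of_nat (Suc k) * (c + of_nat k) * fps_nth F (Suc k)
                - (a + of_nat k) * (b + of_nat k) * fps_nth F k" for k
  proof (cases k)
    case (Suc j)
    thus ?thesis by (cases j) (simp_all add: algebra_simps)
  qed simp
  thus ?thesis
    unfolding satisfies_hypergeometric_ODE_def expand fps_eq_iff by simp
qed

lemma olver_fps_satisfies_hypergeometric_ODE: "satisfies_hypergeometric_ODE a b c (olver_fps a b c)"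
  unfolding satisfies_hypergeometric_ODE_iff
proof
  fix k
  have "rGamma (c + of_nat k) = (c + of_nat k) * rGamma (c + of_nat (Suc k))"
    using rGamma_plus1[of "c + of_nat k"] by (simp add: add_ac)
  thus "of_nat (Suc k) * (c + of_nat k) * fps_nth (olver_fps a b c) (Suc k)
          = (a + of_nat k) * (b + of_nat k) * fps_nth (olver_fps a b c) k"
    by (simp add: olver_fps_def pochhammer_Suc field_simps del: of_nat_Suc)
qed

lemma hypergeometric_ODE_unique:
  assumes F: "satisfies_hypergeometric_ODE a b c F" and G: "satisfies_hypergeometric_ODE a b c G"
    and c: "c \<notin> \<int>\<^sub>\<le>\<^sub>0" and "fps_nth F 0 = fps_nth G 0"
  shows "F = G"
proof (rule fps_ext)
  fix k show "fps_nth F k = fps_nth G k"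
  proof (induction k)
    case (Suc k)
    have "c + of_nat k \<noteq> 0"
      using c plus_of_nat_eq_0_imp by blast
    moreover have "of_nat (Suc k) * (c + of_nat k) * fps_nth F (Suc k)
                 = of_nat (Suc k) * (c + of_nat k) * fps_nth G (Suc k)"
      using F G Suc unfolding satisfies_hypergeometric_ODE_iff by metis
    ultimately show ?case by (simp del: of_nat_Suc)
  qed (use assms in auto)
qed

text \<open>
  In the variable \<open>s = (1 - w)/2\<close>, these are the expansions at \<open>s = 0\<close> of the factor \<open>w powr l\<close> and of
  the argument \<open>1 - 1/w\<^sup>2\<close>.
\<close>

definition quad_power :: "complex \<Rightarrow> complex fps" where
  "quad_power l = fps_binomial l oo (fps_const (-2) * fps_X)"

definition quad_arg :: "complex fps" where
  "quad_arg = 1 - inverse (1 - 2 * fps_X) ^ 2"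

lemma quad_arg_0 [simp]: "fps_nth quad_arg 0 = 0"
  by (simp add: quad_arg_def power2_eq_square)

text \<open>
  With \<open>W = 1 - 2s\<close> standing for \<open>w\<close>, its inverse \<open>J\<close>, the factor \<open>P = w powr l\<close>, and \<open>K\<close>, \<open>K1\<close>, \<open>K2\<close> for \<open>H\<close>
  and its derivatives at \<open>1 - J\<^sup>2\<close>, the rules \<open>J' = 2 J\<^sup>2\<close>, \<open>P' = -2 l P J\<close> and \<open>K' = -4 J\<^sup>3 K1\<close> express
  all derivatives as polynomials in these quantities. The transformed equation is then
  \<open>-4 P J\<^sup>2\<close> times the equation for \<open>H\<close>, modulo \<open>J W = 1\<close>.
\<close>

lemma quadratic_transformation_ODE:
  assumes H: "satisfies_hypergeometric_ODE (- l / 2) ((1 - l) / 2) c H"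
  shows "satisfies_hypergeometric_ODE (- l) (2 * c - 1 + l) c (quad_power l * (H oo quad_arg))"
proof -
  define W J where "W = (1 - 2 * fps_X :: complex fps)" and "J = inverse W"
  define L C where "L = fps_const l" and "C = fps_const c"
  define P where "P = quad_power l"
  define K K1 K2 where "K = H oo quad_arg" and "K1 = fps_deriv H oo quad_arg"
    and "K2 = fps_deriv (fps_deriv H) oo quad_arg"
  have JW: "J * W = 1"
    unfolding J_def by (rule inverse_mult_eq_1) (simp add: W_def)
  have W': "W = 1 + fps_const (-2) * fps_X"
    unfolding neg_numeral_fps_const[symmetric] by (simp add: W_def)
  have dW: "fps_deriv W = -2"
    by (simp add: W_def)
  have dJ: "fps_deriv J = 2 * J ^ 2"
    unfolding J_def by (simp add: fps_inverse_deriv dW W_def)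
  have arg: "quad_arg = 1 - J ^ 2"
    by (simp add: quad_arg_def J_def W_def)
  have darg: "fps_deriv quad_arg = - 4 * J ^ 3"
    unfolding arg by (simp add: dJ power2_eq_square power3_eq_cube)
  have dP: "fps_deriv P = - 2 * L * P * J"
  proof -
    have "fps_deriv (fps_binomial l) * (1 + fps_X) = L * fps_binomial l"
      unfolding fps_binomial_deriv L_def
      by (subst fps_divide_unit) (simp_all add: mult.assoc inverse_mult_eq_1)
    hence "(fps_deriv (fps_binomial l) * (1 + fps_X)) oo (fps_const (-2) * fps_X)
             = (L * fps_binomial l) oo (fps_const (-2) * fps_X)"
      by simp
    hence "(fps_deriv (fps_binomial l) oo (fps_const (-2) * fps_X)) * W = L * P"
      by (simp add: fps_compose_mult_distrib fps_compose_add_distrib P_def quad_power_def L_def W')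
    moreover have "fps_deriv P = (fps_deriv (fps_binomial l) oo (fps_const (-2) * fps_X)) * (- 2)"
      unfolding P_def quad_power_def by (subst fps_compose_deriv) (simp_all add: numeral_fps_const)
    ultimately show ?thesis using JW by algebra
  qed
  have dK: "fps_deriv K = - 4 * J ^ 3 * K1" "fps_deriv K1 = - 4 * J ^ 3 * K2"
    unfolding K_def K1_def K2_def by (simp_all add: fps_compose_deriv darg)
  have d1: "fps_deriv (P * K) = - 2 * L * P * J * K - 4 * P * J ^ 3 * K1"
    by (simp add: dP dK algebra_simps)
  have dL: "fps_deriv L = 0"
    by (simp add: L_def)
  have dJ3: "fps_deriv (J ^ 3) = 6 * J ^ 4"
    unfolding power3_eq_cube fps_deriv_mult dJ by algebra
  have d2: "fps_deriv (fps_deriv (P * K)) =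
    - 4 * L * (1 - L) * P * J ^ 2 * K + (16 * L - 24) * P * J ^ 4 * K1 + 16 * P * J ^ 6 * K2"
    unfolding d1
    unfolding fps_deriv_mult fps_deriv_sub fps_deriv_neg fps_deriv_numeral dP dK dJ dJ3 dL
    by algebra
  \<comment> \<open>The equation for \<open>H\<close> at \<open>1 - J\<^sup>2\<close>; the factor \<open>4\<close> clears the denominators of its parameters.\<close>
  have h: "4 * (1 - J ^ 2) * J ^ 2 * K2 + (4 * C - (6 - 4 * L) * (1 - J ^ 2)) * K1 + L * (1 - L) * K = 0"
  proof -
    have "(4 * (fps_X * (1 - fps_X) * fps_deriv (fps_deriv H)
       + (fps_const c - fps_const (- l / 2 + (1 - l) / 2 + 1) * fps_X) * fps_deriv H - fps_const (- l / 2 * ((1 - l) / 2)) * H)) oo quad_arg = 0"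
      using H by (simp add: satisfies_hypergeometric_ODE_def)
    hence "4 * (quad_arg * (1 - quad_arg) * K2 + (C - fps_const (3 / 2 - l) * quad_arg) * K1 - fps_const (- l / 2 * ((1 - l) / 2)) * K) = 0"
      by (simp add: fps_compose_mult_distrib fps_compose_add_distrib fps_compose_sub_distrib
            K_def K1_def K2_def C_def numeral_fps_const field_simps)
    moreover have "4 * fps_const (3 / 2 - l) = 6 - 4 * L" "4 * fps_const (- l / 2 * ((1 - l) / 2)) = - (L * (1 - L))"
      by (simp_all add: L_def numeral_fps_const fps_eq_iff field_simps)
    ultimately show ?thesis unfolding arg by algebra
  qed
  have X: "2 * fps_X = 1 - W"
    by (simp add: W_def)
  have "4 * (fps_X * (1 - fps_X) * fps_deriv (fps_deriv (P * K))
       + (C - 2 * C * fps_X) * fps_deriv (P * K) + L * (2 * C - 1 + L) * (P * K)) = 0"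
    unfolding d2 unfolding d1 using JW h X by algebra
  hence "fps_X * (1 - fps_X) * fps_deriv (fps_deriv (P * K))
       + (C - 2 * C * fps_X) * fps_deriv (P * K) + L * (2 * C - 1 + L) * (P * K) = 0"
    unfolding numeral_fps_const mult_eq_0_iff by simp
  moreover have "fps_const (- l + (2 * c - 1 + l) + 1) = 2 * C"
      "fps_const (- l * (2 * c - 1 + l)) = - (L * (2 * C - 1 + L))"
    by (simp_all add: L_def C_def numeral_fps_const fps_eq_iff)
  ultimately show ?thesis
    unfolding satisfies_hypergeometric_ODE_def P_def[symmetric] K_def[symmetric] C_def[symmetric]
    by (simp only: minus_mult_left[symmetric] diff_minus_eq_add)
qed

text \<open>
  If \<open>c\<close> is a nonpositive integer, the value at \<open>0\<close> no longer determines a solution of the equation.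
  Such \<open>c\<close> are isolated, and each coefficient of either side is a continuous function of \<open>c\<close>.
\<close>

lemma olver_fps_quadratic_transformation:
  "quad_power l * (olver_fps (- l / 2) ((1 - l) / 2) c oo quad_arg) = olver_fps (- l) (2 * c - 1 + l) c"
proof -
  have generic: "quad_power l * (olver_fps (- l / 2) ((1 - l) / 2) c oo quad_arg) = olver_fps (- l) (2 * c - 1 + l) c"
    if "c \<notin> \<int>\<^sub>\<le>\<^sub>0" for c
  proof (rule hypergeometric_ODE_unique[OF quadratic_transformation_ODE olver_fps_satisfies_hypergeometric_ODE])
    show "satisfies_hypergeometric_ODE (- l / 2) ((1 - l) / 2) c (olver_fps (- l / 2) ((1 - l) / 2) c)"
      by (rule olver_fps_satisfies_hypergeometric_ODE)
  qed (simp_all add: that quad_power_def olver_fps_def)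
  show ?thesis
  proof (cases "c \<in> \<int>\<^sub>\<le>\<^sub>0")
    case True
    show ?thesis
    proof (rule fps_ext)
      fix n
      let ?f = "\<lambda>c. fps_nth (quad_power l * (olver_fps (- l / 2) ((1 - l) / 2) c oo quad_arg)) n"
      let ?g = "\<lambda>c. fps_nth (olver_fps (- l) (2 * c - 1 + l) c) n"
      have "continuous_on UNIV ?f"
        unfolding fps_mult_nth fps_compose_nth olver_fps_def fps_nth_Abs_fps
        by (intro holomorphic_on_imp_continuous_on holomorphic_intros) auto
      hence f: "(?f \<longlongrightarrow> ?f c) (at c)"
        by (simp add: continuous_on_def)
      have "continuous_on UNIV ?g"
        unfolding olver_fps_def fps_nth_Abs_fps
        by (intro holomorphic_on_imp_continuous_on holomorphic_intros) auto
      hence g: "(?g \<longlongrightarrow> ?g c) (at c)"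
        by (simp add: continuous_on_def)
      have "eventually (\<lambda>c'. c' \<in> ball c 1 - {c}) (at c)"
        by (rule eventually_at_in_open) auto
      hence "eventually (\<lambda>c'. ?f c' = ?g c') (at c)"
      proof eventually_elim
        case (elim c')
        have "c' \<notin> \<int>\<^sub>\<le>\<^sub>0"
        proof
          assume "c' \<in> \<int>\<^sub>\<le>\<^sub>0"
          then obtain m m' :: int where m: "c = of_int m" "c' = of_int m'"
            using True by (auto elim!: nonpos_Ints_cases)
          have "\<bar>real_of_int (m - m')\<bar> < 1"
            using elim by (simp add: m dist_norm flip: of_int_diff)
          hence "m = m'" by linarith
          thus False using elim m by simp
        qed
        thus ?case using generic by simp
      qed
      hence "(?g \<longlongrightarrow> ?f c) (at c)"
        using f by (rule Lim_transform_eventually[rotated])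
      thus "?f c = ?g c"
        using g by (rule tendsto_unique[rotated]) auto
    qed
  qed (rule generic)
qed

lemma Re_inverse_pos: "Re (inverse z) > 0 \<longleftrightarrow> Re z > 0"
  by (cases "z = 0") (auto simp: zero_less_divide_iff complex_eq_iff sum_power2_gt_zero_iff not_sum_power2_lt_zero)

text \<open>
  The identity theorem in the half plane \<open>Re s < 1/2\<close>. There \<open>w = 1 - 2s\<close> and hence \<open>1/w\<close> have
  positive real part, so \<open>1/w\<^sup>2\<close> is never a nonpositive real number and \<open>1 - 1/w\<^sup>2\<close> stays in the cut
  plane.
\<close>

theorem olver_2F1_quadratic_transformation:
  assumes w: "Re w > 0"
  shows "olver_2F1 (- l) (2 * c - 1 + l) c ((1 - w) / 2)
           = w powr l * olver_2F1 (- l / 2) ((1 - l) / 2) c (1 - 1 / w\<^sup>2)"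
proof -
  let ?F = "olver_2F1 (- l) (2 * c - 1 + l) c" and ?H = "olver_2F1 (- l / 2) ((1 - l) / 2) c"
  let ?arg = "\<lambda>s::complex. 1 - inverse (1 - 2 * s) ^ 2"
  let ?S = "{s. Re s < 1 / 2}"
  let ?d = "\<lambda>s. ?F s - (1 - 2 * s) powr l * ?H (?arg s)"
  have "?d ((1 - w) / 2) = 0"
  proof (rule has_fps_expansion_0_analytic_continuation[where f = ?d and A = ?S])
    have "((\<lambda>s. (1 + s) powr l) \<circ> (\<lambda>s. (-2) * s)) has_fps_expansion quad_power l"
      unfolding quad_power_def by (intro fps_expansion_intros) auto
    hence P: "(\<lambda>s. (1 - 2 * s) powr l) has_fps_expansion quad_power l"
      by (simp add: o_def)
    have "?arg has_fps_expansion quad_arg"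
      unfolding quad_arg_def by (intro fps_expansion_intros) auto
    hence "(?H \<circ> ?arg) has_fps_expansion (olver_fps (- l / 2) ((1 - l) / 2) c oo quad_arg)"
      by (intro has_fps_expansion_compose has_fps_expansion_olver_2F1) auto
    hence "?d has_fps_expansion (olver_fps (- l) (2 * c - 1 + l) c
             - quad_power l * (olver_fps (- l / 2) ((1 - l) / 2) c oo quad_arg))"
      unfolding o_def by (intro fps_expansion_intros has_fps_expansion_olver_2F1 P)
    thus "?d has_fps_expansion 0"
      by (simp only: olver_fps_quadratic_transformation diff_self)
    show "?d holomorphic_on ?S"
    proof -
      have "?S \<subseteq> cut_plane" by (auto simp: mem_cut_plane)
      hence "?F holomorphic_on ?S" using holomorphic_olver_2F1 holomorphic_on_subset by blast
      moreover have "(\<lambda>s. (1 - 2 * s) powr l) holomorphic_on ?S"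
        by (intro holomorphic_intros) (auto simp: complex_nonpos_Reals_iff)
      moreover have "?H \<circ> ?arg holomorphic_on ?S"
      proof (rule holomorphic_on_compose_gen[OF _ holomorphic_olver_2F1])
        show "?arg holomorphic_on ?S"
          by (intro holomorphic_intros) (auto simp: complex_eq_iff)
        have "?arg s \<in> cut_plane" if "Re s < 1 / 2" for s
        proof (rule ccontr)
          assume "?arg s \<notin> cut_plane"
          hence 1: "Im (inverse (1 - 2 * s) ^ 2) = 0" "Re (inverse (1 - 2 * s) ^ 2) \<le> 0"
            by (auto simp: mem_cut_plane)
          define v where "v = inverse (1 - 2 * s)"
          have "Re v > 0"
            using that unfolding v_def Re_inverse_pos by simp
          with 1[folded v_def] show False
            by (auto simp: Re_power2 Im_power2)
        qed
        thus "?arg ` ?S \<subseteq> cut_plane" by auto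
      qed
      ultimately show ?thesis
        unfolding o_def by (intro holomorphic_on_diff holomorphic_on_mult)
    qed
  qed (use w in \<open>simp_all add: open_halfspace_Re_lt convex_connected convex_halfspace_Re_lt
       del: less_divide_eq_numeral1\<close>)
  moreover have "1 - 2 * ((1 - w) / 2) = w" by (simp add: field_simps)
  ultimately show ?thesis
    by (simp add: field_simps)
qed

section \<open>Gegenbauer and Jacobi functions\<close>

lemma olver_2F1_commute: "olver_2F1 a b c z = olver_2F1 b a c z"
  unfolding olver_2F1_def by (simp only: mult.commute)

lemma Re_one_minus_square_pos:
  assumes "norm (w :: complex) < 1"
  shows "Re (1 - w\<^sup>2) > 0"
proof -
  have "norm (w\<^sup>2) < 1"
    using assms by (simp add: norm_power power_less_one_iff)
  thus ?thesis
    using complex_Re_le_cmod[of "w\<^sup>2"] by simp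
qed

text \<open>
  The imaginary part \<open>s\<close> of the right-hand side is the difference of the arguments of \<open>w\<^sup>2\<close> and
  \<open>u = 1 - w\<^sup>2\<close>, which a priori only satisfies \<open>\<bar>s\<bar> < 3\<pi>/2\<close>. But \<open>s\<close> has the sign of \<open>Im w\<close>, and so does
  \<open>sin s\<close>, because \<open>w\<^sup>2/u = 1/u - 1\<close> has imaginary part \<open>2 Re w Im w / \<bar>u\<bar>\<^sup>2\<close>. This forces \<open>\<bar>s\<bar> < \<pi>\<close>.
\<close>

lemma Ln_square_over_one_minus_square:
  assumes w: "Re w > 0" "norm w < 1"
  shows "Ln (w\<^sup>2 / (1 - w\<^sup>2)) = 2 * Ln w - Ln (1 - w\<^sup>2)"
proof -
  define u where "u = 1 - w\<^sup>2"
  define s where "s = 2 * Im (Ln w) - Im (Ln u)"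
  have u: "Re u > 0"
    using Re_one_minus_square_pos[OF w(2)] by (simp add: u_def)
  have nz: "w \<noteq> 0" "u \<noteq> 0" using w u by auto
  have exp_v: "exp (2 * Ln w - Ln u) = w\<^sup>2 / u"
    using nz by (simp add: exp_diff exp_double)
  have bounds: "\<bar>Im (Ln w)\<bar> < pi / 2" "\<bar>Im (Ln u)\<bar> < pi / 2"
    using Re_Ln_pos_lt nz w u by auto
  have Im_Ln_neg: "Im (Ln x) < 0" if "x \<noteq> 0" "\<bar>Im (Ln x)\<bar> < pi / 2" "Im x < 0" for x
  proof (rule ccontr)
    assume "\<not> Im (Ln x) < 0"
    hence "0 \<le> Im (Ln x) \<and> Im (Ln x) \<le> pi"
      using that(2) pi_gt_zero by linarith
    thus False
      using Im_Ln_pos_le[OF that(1)] that(3) by simp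
  qed
  have Im_u: "Im u = - 2 * Re w * Im w"
    by (simp add: u_def Im_power2)
  have "sin s * exp (Re (2 * Ln w - Ln u)) = Im (w\<^sup>2 / u)"
    unfolding exp_v[symmetric] Im_exp by (simp add: s_def)
  moreover have "Im (w\<^sup>2 / u) = Im (w\<^sup>2) / norm u ^ 2"
  proof -
    have "w\<^sup>2 / u = 1 / u - 1" using nz by (simp add: u_def field_simps)
    thus ?thesis using nz
      by (simp add: Im_divide cmod_power2 Im_u Im_power2)
  qed
  ultimately have sin_s: "sin s * exp (Re (2 * Ln w - Ln u)) = 2 * Re w * Im w / norm u ^ 2"
    by (simp add: Im_power2)
  have "\<bar>s\<bar> < pi"
  proof (cases "Im w" "0 :: real" rule: linorder_cases)
    case equal
    hence "Im (Ln w) = 0" using w Im_Ln_eq_0[OF nz(1)] by simp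
    thus ?thesis using bounds pi_gt_zero unfolding s_def by linarith
  next
    case greater
    have "Im u < 0" unfolding Im_u using greater w by (simp add: mult_pos_neg)
    hence "Im (Ln u) < 0"
      using Im_Ln_neg nz bounds by blast
    moreover have "Im (Ln w) > 0"
      using Im_Ln_pos_lt[OF nz(1)] greater by simp
    ultimately have "0 < s" "s < 2 * pi" using bounds unfolding s_def by linarith+
    moreover have "sin s > 0"
    proof -
      have "2 * Re w * Im w / norm u ^ 2 > 0" using greater w nz by simp
      thus ?thesis unfolding sin_s[symmetric] by (simp add: zero_less_mult_iff)
    qed
    ultimately show ?thesis using sin_le_zero[of s] by linarith
  next
    case less
    have "Im u > 0" unfolding Im_u using less w by (simp add: mult_pos_neg)
    hence "Im (Ln u) > 0"
      using Im_Ln_pos_lt[OF nz(2)] by simp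
    moreover have "Im (Ln w) < 0"
      using Im_Ln_neg nz less bounds by blast
    ultimately have "0 < - s" "- s < 2 * pi" using bounds unfolding s_def by linarith+
    moreover have "sin (- s) > 0"
    proof -
      have "2 * Re w * Im w / norm u ^ 2 < 0" using less w nz by (simp add: divide_neg_pos mult_pos_neg)
      thus ?thesis unfolding sin_s[symmetric] by (simp add: mult_less_0_iff)
    qed
    ultimately show ?thesis using sin_le_zero[of "- s"] by linarith
  qed
  hence "- pi < Im (2 * Ln w - Ln u)" "Im (2 * Ln w - Ln u) \<le> pi"
    by (auto simp: s_def)
  hence "Ln (exp (2 * Ln w - Ln u)) = 2 * Ln w - Ln u"
    by (rule Ln_exp)
  thus ?thesis unfolding exp_v by (simp add: u_def)
qed

text \<open>
  In the right half disc the principal powers of \<open>x - 1 = 2w\<^sup>2/u\<close> and \<open>x + 1 = 2/u\<close>, where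
  \<open>u = 1 - w\<^sup>2\<close>, split into powers of \<open>2\<close>, \<open>w\<close> and \<open>u\<close>. The total exponent of \<open>2\<close> is \<open>-1\<close>.
\<close>

lemma jacobi_Q_right_half_disc:
  assumes w: "Re w > 0" "norm w < 1"
  shows "jacobi_Q \<gamma> \<alpha> \<beta> ((1 + w\<^sup>2) / (1 - w\<^sup>2)) =
           Gamma (\<alpha> + \<gamma> + 1) * Gamma (\<beta> + \<gamma> + 1) / 2
           * (1 - w\<^sup>2) powr (\<alpha> + \<beta> + \<gamma> + 1) * w powr (- 2 * (\<alpha> + \<gamma> + 1))
           * olver_2F1 (\<gamma> + 1) (\<alpha> + \<gamma> + 1) (\<alpha> + \<beta> + 2 * \<gamma> + 2) (1 - 1 / w\<^sup>2)"
proof -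
  define u p where "u = 1 - w\<^sup>2" and "p = \<alpha> + \<gamma> + 1"
  have u: "Re u > 0"
    using Re_one_minus_square_pos[OF w(2)] by (simp add: u_def)
  have nz: "w \<noteq> 0" "u \<noteq> 0" using w u by auto
  have w2: "w\<^sup>2 = 1 - u" by (simp add: u_def)
  have args: "(1 + w\<^sup>2) / u - 1 = 2 * (w\<^sup>2 / u)" "(1 + w\<^sup>2) / u + 1 = 2 * (1 / u)"
      "2 / (1 - (1 + w\<^sup>2) / u) = 1 - 1 / w\<^sup>2"
  proof -
    show "(1 + w\<^sup>2) / u - 1 = 2 * (w\<^sup>2 / u)" "(1 + w\<^sup>2) / u + 1 = 2 * (1 / u)"
      unfolding w2 using nz by (simp_all add: field_simps)
    have "1 - (1 + w\<^sup>2) / u = - 2 * w\<^sup>2 / u"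
      unfolding w2 using nz by (simp add: field_simps)
    moreover have "2 / (- 2 * w\<^sup>2 / u) = - (u / w\<^sup>2)"
      using nz by (simp add: field_simps)
    moreover have "- (u / w\<^sup>2) = 1 - 1 / w\<^sup>2"
      using nz by (simp add: u_def field_simps)
    ultimately show "2 / (1 - (1 + w\<^sup>2) / u) = 1 - 1 / w\<^sup>2" by simp
  qed
  have Ln1: "Ln (2 * (w\<^sup>2 / u)) = Ln 2 + (2 * Ln w - Ln u)"
    using Ln_square_over_one_minus_square[OF w] nz
    by (subst Ln_times_of_real[of 2, simplified]) (simp_all add: u_def Ln_of_real[of 2, simplified])
  have Ln2: "Ln (2 * (1 / u)) = Ln 2 - Ln u"
    using nz u by (subst Ln_times_of_real[of 2, simplified])
      (simp_all add: Ln_of_real[of 2, simplified] Ln_inverse complex_nonpos_Reals_iff flip: inverse_eq_divide)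
  have P1: "(2 * (w\<^sup>2 / u)) powr p = exp (p * (Ln 2 + (2 * Ln w - Ln u)))"
    using nz by (simp add: powr_def flip: Ln1)
  have P2: "(2 * (1 / u)) powr \<beta> = exp (\<beta> * (Ln 2 - Ln u))"
    using nz by (simp add: powr_def flip: Ln2)
  have "2 powr (\<alpha> + \<beta> + \<gamma>) / ((2 * (w\<^sup>2 / u)) powr p * (2 * (1 / u)) powr \<beta>)
          = exp (- Ln 2) * u powr (p + \<beta>) * w powr (- 2 * p)"
    unfolding P1 P2 using nz
    by (simp add: powr_def p_def flip: exp_add exp_diff) (simp add: algebra_simps)
  hence pow: "2 powr (\<alpha> + \<beta> + \<gamma>) / ((2 * (w\<^sup>2 / u)) powr p * (2 * (1 / u)) powr \<beta>)
          = u powr (p + \<beta>) * w powr (- 2 * p) / 2"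
    by (simp add: exp_minus field_simps)
  have "jacobi_Q \<gamma> \<alpha> \<beta> ((1 + w\<^sup>2) / u) =
     2 powr (\<alpha> + \<beta> + \<gamma>) / ((2 * (w\<^sup>2 / u)) powr p * (2 * (1 / u)) powr \<beta>) *
       (Gamma p * Gamma (\<beta> + \<gamma> + 1) *
        olver_2F1 (\<gamma> + 1) p (\<alpha> + \<beta> + 2 * \<gamma> + 2) (1 - 1 / w\<^sup>2))"
    unfolding jacobi_Q_def args p_def[symmetric] by simp
  moreover have pb: "p + \<beta> = \<alpha> + \<beta> + \<gamma> + 1" by (simp add: p_def)
  ultimately show ?thesis
    unfolding pow pb by (simp add: u_def p_def mult_ac)
qed

text \<open>
  Admissibility says that \<open>2s\<close> is not a pole of \<open>\<Gamma>\<close> for \<open>s = m + l/2\<close>. This excludes poles at both \<open>s\<close>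
  and \<open>s + 1/2\<close>, as the duplication formula requires.
\<close>

lemma gegenbauer_C_right_half_plane:
  assumes "Re w > 0" and adm: "gegenbauer_admissible l m"
  shows "gegenbauer_C l m w =
           2 powr l * Gamma (m + l / 2) * Gamma (m + l / 2 + 1 / 2) * rGamma m * rGamma (l + 1)
           * w powr l * olver_2F1 (- l / 2) ((1 - l) / 2) (m + 1 / 2) (1 - 1 / w\<^sup>2)"
proof -
  define s where "s = m + l / 2"
  have s2: "2 * s = l + 2 * m" by (simp add: s_def field_simps)
  have "s \<notin> \<int>\<^sub>\<le>\<^sub>0" "s + 1 / 2 \<notin> \<int>\<^sub>\<le>\<^sub>0"
  proof -
    have no: "2 * s \<noteq> - of_nat n" for n
      using adm by (auto simp: gegenbauer_admissible_def s2)
    show "s \<notin> \<int>\<^sub>\<le>\<^sub>0"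
    proof
      assume "s \<in> \<int>\<^sub>\<le>\<^sub>0"
      then obtain n where "s = - of_nat n" by (elim nonpos_Ints_cases')
      thus False using no[of "2 * n"] by simp
    qed
    show "s + 1 / 2 \<notin> \<int>\<^sub>\<le>\<^sub>0"
    proof
      assume "s + 1 / 2 \<in> \<int>\<^sub>\<le>\<^sub>0"
      then obtain n where "s + 1 / 2 = - of_nat n" by (elim nonpos_Ints_cases')
      hence "s = - of_nat n - 1 / 2" by (simp add: eq_diff_eq)
      thus False using no[of "2 * n + 1"] by simp
    qed
  qed
  hence "Gamma s * Gamma (s + 1 / 2) = exp ((1 - 2 * s) * of_real (ln 2)) * of_real (sqrt pi) * Gamma (l + 2 * m)"
    using Gamma_legendre_duplication[of s] by (simp add: s2)
  also have "exp ((1 - 2 * s) * of_real (ln 2)) = 2 powr (1 - 2 * s)"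
    by (simp add: powr_def Ln_of_real[of 2, simplified])
  also have "1 - 2 * s = - l - (2 * m - 1)" by (simp add: s2)
  also have "2 powr (- l - (2 * m - 1)) = 1 / (2 powr l * 2 powr (2 * m - 1) :: complex)"
    unfolding powr_diff[of 2 "- l" "2 * m - 1"] powr_minus by (simp add: field_simps)
  finally have dup: "of_real (sqrt pi) * Gamma (l + 2 * m) / 2 powr (2 * m - 1) = 2 powr l * Gamma s * Gamma (s + 1 / 2)"
    by (simp add: field_simps)
  have "olver_2F1 (- l) (2 * m + l) (m + 1 / 2) ((1 - w) / 2)
          = w powr l * olver_2F1 (- l / 2) ((1 - l) / 2) (m + 1 / 2) (1 - 1 / w\<^sup>2)"
    using olver_2F1_quadratic_transformation[OF assms(1), of l "m + 1 / 2"] by simp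
  thus ?thesis
    unfolding gegenbauer_C_def dup s_def[symmetric] by (simp add: mult_ac)
qed

lemma holomorphic_gegenbauer_C: "gegenbauer_C l m holomorphic_on ball 0 1"
proof -
  have "olver_2F1 a b c \<circ> (\<lambda>z. (1 - z) / 2) holomorphic_on ball 0 1" for a b c
  proof (rule holomorphic_on_compose_gen[OF _ holomorphic_olver_2F1])
    show "(\<lambda>z. (1 - z) / 2) ` ball 0 1 \<subseteq> cut_plane"
    proof
      fix y assume "y \<in> (\<lambda>z::complex. (1 - z) / 2) ` ball 0 1"
      then obtain z :: complex where z: "norm z < 1" "y = (1 - z) / 2" by auto
      have "- Re z \<le> norm z" using abs_Re_le_cmod[of z] by linarith
      thus "y \<in> cut_plane" unfolding z(2) using z(1) by (simp add: mem_cut_plane)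
    qed
  qed (auto intro!: holomorphic_intros)
  thus ?thesis
    unfolding gegenbauer_C_def o_def by (intro holomorphic_intros) auto
qed

theorem theorem2p22:
  fixes z \<beta> \<gamma> :: complex
  assumes "cmod z < 1"
    and "\<beta> + \<gamma> + 1 / 2 \<notin> \<int>\<^sub>\<le>\<^sub>0"
  shows "(gegenbauer_admissible (2 * \<gamma> + 1) \<beta> \<and>
          jacobi_Q_admissible (- \<gamma> - 1) (- 1 / 2) (\<beta> + 2 * \<gamma> + 1) \<longrightarrow>
          (\<exists>F. unit_disc_continuation
                 (\<lambda>w. 2 powr (2 * \<gamma> + 2) * Gamma (\<beta> + \<gamma> + 1 / 2)
                        * rGamma (- \<gamma> - 1 / 2) * rGamma (2 * \<gamma> + 2) * rGamma \<beta>
                        / (1 - w\<^sup>2) powr (\<beta> + \<gamma> + 1 / 2)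
                        * jacobi_Q (- \<gamma> - 1) (- 1 / 2) (\<beta> + 2 * \<gamma> + 1)
                            ((1 + w\<^sup>2) / (1 - w\<^sup>2))) F \<and>
               gegenbauer_C (2 * \<gamma> + 1) \<beta> z = F z))
       \<and> (gegenbauer_admissible (2 * \<gamma>) \<beta> \<and>
          jacobi_Q_admissible (- \<gamma> - 1) (1 / 2) (\<beta> + 2 * \<gamma>) \<longrightarrow>
          (\<exists>F. unit_disc_continuation
                 (\<lambda>w. 2 powr (2 * \<gamma> + 1) * Gamma (\<beta> + \<gamma> + 1 / 2) * w
                        * rGamma (- \<gamma> + 1 / 2) * rGamma (2 * \<gamma> + 1) * rGamma \<beta>
                        / (1 - w\<^sup>2) powr (\<beta> + \<gamma> + 1 / 2)
                        * jacobi_Q (- \<gamma> - 1) (1 / 2) (\<beta> + 2 * \<gamma>)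
                            ((1 + w\<^sup>2) / (1 - w\<^sup>2))) F \<and>
               gegenbauer_C (2 * \<gamma>) \<beta> z = F z))"
proof -
  have nz: "w \<noteq> 0" "1 - w\<^sup>2 \<noteq> 0" if "Re w > 0" "norm w < 1" for w :: complex
    using that Re_one_minus_square_pos[OF that(2)] by auto
  have half: "2 powr (x + 1) = (2 * 2 powr x :: complex)" for x
    by (simp add: powr_add)
  \<comment> \<open>\<open>J\<close> is the Jacobi function, \<open>G\<close> its Gamma factor cancelled by the prefactor \<open>r\<close>, and \<open>U\<close> the power
      of \<open>1 - w\<^sup>2\<close>. The factor \<open>v\<close> is \<open>w\<close> for degree \<open>2\<gamma>\<close> and \<open>1\<close> for degree \<open>2\<gamma> + 1\<close>.\<close>
  have cancel: "2 * A * B * v * r * C * D / U * J = A * B * E * D * C * (v * W) * H"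
    if "J = G * E / 2 * U * W * H" "r * G = 1" "U \<noteq> 0" for A B C D E G H J U W r v :: complex
  proof -
    have "2 * A * B * v * r * C * D / U * J = (r * G) * (U / U) * (A * B * E * D * C * (v * W) * H)"
      unfolding that(1) by simp
    thus ?thesis using that(2,3) by simp
  qed
  show ?thesis
  proof (intro conjI impI exI)
    assume A: "gegenbauer_admissible (2 * \<gamma> + 1) \<beta> \<and>
          jacobi_Q_admissible (- \<gamma> - 1) (- 1 / 2) (\<beta> + 2 * \<gamma> + 1)"
    hence "- \<gamma> - 1 / 2 \<notin> \<int>\<^sub>\<le>\<^sub>0"
      by (simp add: jacobi_Q_admissible_def add.commute)
    hence rG: "rGamma (- \<gamma> - 1 / 2) * Gamma (- \<gamma> - 1 / 2) = 1"
      by (simp add: rGamma_inverse_Gamma Gamma_eq_zero_iff)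
    show "unit_disc_continuation
                 (\<lambda>w. 2 powr (2 * \<gamma> + 2) * Gamma (\<beta> + \<gamma> + 1 / 2)
                        * rGamma (- \<gamma> - 1 / 2) * rGamma (2 * \<gamma> + 2) * rGamma \<beta>
                        / (1 - w\<^sup>2) powr (\<beta> + \<gamma> + 1 / 2)
                        * jacobi_Q (- \<gamma> - 1) (- 1 / 2) (\<beta> + 2 * \<gamma> + 1)
                            ((1 + w\<^sup>2) / (1 - w\<^sup>2))) (gegenbauer_C (2 * \<gamma> + 1) \<beta>)"
      unfolding unit_disc_continuation_def
    proof (intro conjI ballI impI holomorphic_gegenbauer_C)
      fix w :: complex assume "w \<in> ball 0 1" and w: "Re w > 0"
      hence w1: "norm w < 1" by simp
      let ?F = "olver_2F1 (- \<gamma>) (- \<gamma> - 1 / 2) (\<beta> + 1 / 2) (1 - 1 / w\<^sup>2)"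
      have jac: "jacobi_Q (- \<gamma> - 1) (- 1 / 2) (\<beta> + 2 * \<gamma> + 1) ((1 + w\<^sup>2) / (1 - w\<^sup>2)) =
              Gamma (- \<gamma> - 1 / 2) * Gamma (\<beta> + \<gamma> + 1) / 2
              * (1 - w\<^sup>2) powr (\<beta> + \<gamma> + 1 / 2) * w powr (2 * \<gamma> + 1) * ?F"
        by (subst jacobi_Q_right_half_disc[OF w w1]) (simp add: algebra_simps)
      have geg: "gegenbauer_C (2 * \<gamma> + 1) \<beta> w =
           2 powr (2 * \<gamma> + 1) * Gamma (\<beta> + \<gamma> + 1 / 2) * Gamma (\<beta> + \<gamma> + 1)
           * rGamma \<beta> * rGamma (2 * \<gamma> + 2) * w powr (2 * \<gamma> + 1) * ?F"
      proof -
        have e: "- (2 * \<gamma> + 1) / 2 = - \<gamma> - 1 / 2" "(1 - (2 * \<gamma> + 1)) / 2 = - \<gamma>"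
            "\<beta> + (2 * \<gamma> + 1) / 2 = \<beta> + \<gamma> + 1 / 2" "\<beta> + \<gamma> + 1 / 2 + 1 / 2 = \<beta> + \<gamma> + 1"
            "2 * \<gamma> + 1 + 1 = 2 * \<gamma> + 2"
          by (simp_all add: field_simps)
        show ?thesis
          using gegenbauer_C_right_half_plane[OF w conjunct1[OF A]]
          unfolding e olver_2F1_commute[of "- \<gamma> - 1 / 2" "- \<gamma>"] .
      qed
      have two_powr: "2 powr (2 * \<gamma> + 2) = (2 * 2 powr (2 * \<gamma> + 1) :: complex)"
        using half[of "2 * \<gamma> + 1"] by (simp add: add.assoc)
      show "gegenbauer_C (2 * \<gamma> + 1) \<beta> w =
            2 powr (2 * \<gamma> + 2) * Gamma (\<beta> + \<gamma> + 1 / 2)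
                        * rGamma (- \<gamma> - 1 / 2) * rGamma (2 * \<gamma> + 2) * rGamma \<beta>
                        / (1 - w\<^sup>2) powr (\<beta> + \<gamma> + 1 / 2)
                        * jacobi_Q (- \<gamma> - 1) (- 1 / 2) (\<beta> + 2 * \<gamma> + 1)
                            ((1 + w\<^sup>2) / (1 - w\<^sup>2))"
        using cancel[OF jac rG, of "2 powr (2 * \<gamma> + 1)" "Gamma (\<beta> + \<gamma> + 1 / 2)" 1]
          two_powr nz[OF w w1] geg by (simp add: powr_eq_0_iff)
    qed
  next
    assume A: "gegenbauer_admissible (2 * \<gamma>) \<beta> \<and>
          jacobi_Q_admissible (- \<gamma> - 1) (1 / 2) (\<beta> + 2 * \<gamma>)"
    hence "- \<gamma> + 1 / 2 \<notin> \<int>\<^sub>\<le>\<^sub>0"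
      by (simp add: jacobi_Q_admissible_def add.commute)
    hence rG: "rGamma (- \<gamma> + 1 / 2) * Gamma (- \<gamma> + 1 / 2) = 1"
      by (simp add: rGamma_inverse_Gamma Gamma_eq_zero_iff)
    show "unit_disc_continuation
                 (\<lambda>w. 2 powr (2 * \<gamma> + 1) * Gamma (\<beta> + \<gamma> + 1 / 2) * w
                        * rGamma (- \<gamma> + 1 / 2) * rGamma (2 * \<gamma> + 1) * rGamma \<beta>
                        / (1 - w\<^sup>2) powr (\<beta> + \<gamma> + 1 / 2)
                        * jacobi_Q (- \<gamma> - 1) (1 / 2) (\<beta> + 2 * \<gamma>)
                            ((1 + w\<^sup>2) / (1 - w\<^sup>2))) (gegenbauer_C (2 * \<gamma>) \<beta>)"
      unfolding unit_disc_continuation_def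
    proof (intro conjI ballI impI holomorphic_gegenbauer_C)
      fix w :: complex assume "w \<in> ball 0 1" and w: "Re w > 0"
      hence w1: "norm w < 1" by simp
      let ?F = "olver_2F1 (- \<gamma>) (- \<gamma> + 1 / 2) (\<beta> + 1 / 2) (1 - 1 / w\<^sup>2)"
      have jac: "jacobi_Q (- \<gamma> - 1) (1 / 2) (\<beta> + 2 * \<gamma>) ((1 + w\<^sup>2) / (1 - w\<^sup>2)) =
              Gamma (- \<gamma> + 1 / 2) * Gamma (\<beta> + \<gamma>) / 2
              * (1 - w\<^sup>2) powr (\<beta> + \<gamma> + 1 / 2) * w powr (2 * \<gamma> - 1) * ?F"
        by (subst jacobi_Q_right_half_disc[OF w w1]) (simp add: algebra_simps)
      have geg: "gegenbauer_C (2 * \<gamma>) \<beta> w =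
           2 powr (2 * \<gamma>) * Gamma (\<beta> + \<gamma>) * Gamma (\<beta> + \<gamma> + 1 / 2)
           * rGamma \<beta> * rGamma (2 * \<gamma> + 1) * w powr (2 * \<gamma>) * ?F"
        using gegenbauer_C_right_half_plane[OF w conjunct1[OF A]]
        by (simp add: diff_divide_distrib algebra_simps)
      have w_powr: "w powr (2 * \<gamma>) = w * w powr (2 * \<gamma> - 1)"
        using nz[OF w w1] by (simp add: powr_diff)
      show "gegenbauer_C (2 * \<gamma>) \<beta> w =
            2 powr (2 * \<gamma> + 1) * Gamma (\<beta> + \<gamma> + 1 / 2) * w
                        * rGamma (- \<gamma> + 1 / 2) * rGamma (2 * \<gamma> + 1) * rGamma \<beta>
                        / (1 - w\<^sup>2) powr (\<beta> + \<gamma> + 1 / 2)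
                        * jacobi_Q (- \<gamma> - 1) (1 / 2) (\<beta> + 2 * \<gamma>)
                            ((1 + w\<^sup>2) / (1 - w\<^sup>2))"
        unfolding half geg w_powr
        by (subst cancel[OF jac rG]) (use nz[OF w w1] in \<open>simp_all add: powr_eq_0_iff mult_ac\<close>)
    qed
  qed (rule refl)+
qed

end
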